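(* Let $q$ be a prime power, $n\ge1$ an integer, and let $f(x),g(x),h(x)\in\mathbf{F}_q[x]$ be monic polynomials of degree less than $n$ such that $f(x)$ and $g(x)$ divide $x^n-1$. Then $$d_q^e(f,g,h)=\min\Big\{ d([g]),\ d\big([(x^n-1)/\gcd(x^n-1,h)]\big),\ d\big([\mathrm{lcm}(f,\,g/\gcd(g,h))]\big),\ d([f])+d([\gcd(hf,g)])\Big\}$$ is a lower bound for the minimum (Hamming) distance of the quasi-cyclic code $Q_q(f,g,h)\subset\mathbf{F}_q^{2n}$.
   Context: $R=\mathbf{F}_q[x]/(x^n-1)$ and $[a(x)]$ is the class of $a(x)$ in $R$. A vector $(a_0,\ldots,a_{n-1})\in\mathbf{F}_q^n$ is identified with $[a_0+a_1x+\cdots+a_{n-1}x^{n-1}]\in R$, and $\mathbf{F}_q^{2n}$ is identified with $R^2$ accordingly (first $n$ coordinates, last $n$ coordinates). $Q_q(f,g,h)$ is the $R$-submodule of $R^2$ generated by $([f(x)],[h(x)f(x)])$ and $(0,[g(x)])$. $d([u(x)])$ is the minimum Hamming distance of the cyclic code (ideal of $R$) generated by $[u(x)]$, i.e. the minimum Hamming weight of its nonzero elements, with the convention that it is $+\infty$ if this code is zero. *)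

theory Defs
  imports
    "HOL-Algebra.Algebraic_Closure_Type"
    "HOL-Algebra.QuotRing"
    "HOL-Algebra.Chinese_Remainder"
    "HOL-Algebra.Module"
    "HOL-Computational_Algebra.Computational_Algebra"
    "HOL-Number_Theory.Prime_Powers"
    "HOL-Library.Extended_Nat"
begin

text \<open>
  The alphabet is a type of sort \<open>{field_gcd, finite}\<close>. The class \<open>field_gcd\<close> carries, on top of
  \<open>field\<close>, the operations needed for the normalised (that is, monic) \<open>gcd\<close> and \<open>lcm\<close> of the library
  on polynomials; such operations exist on every field, so this is no restriction on the field.
\<close>

abbreviation poly_ring_of_type :: "'a::field poly ring"
  where "poly_ring_of_type \<equiv> ring_of_type_algebra"

definition cyc_modulus :: "nat \<Rightarrow> 'a::field poly"
  where "cyc_modulus n = Polynomial.monom 1 n - 1"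

definition cyc_ideal :: "nat \<Rightarrow> 'a::field poly set"
  where "cyc_ideal n = PIdl\<^bsub>poly_ring_of_type\<^esub> (cyc_modulus n)"

definition cyc_ring :: "nat \<Rightarrow> 'a::field poly set ring"
  where "cyc_ring n = poly_ring_of_type Quot (cyc_ideal n)"

definition cyc_class :: "nat \<Rightarrow> 'a::field poly \<Rightarrow> 'a poly set"
  where "cyc_class n a = cyc_ideal n +>\<^bsub>poly_ring_of_type\<^esub> a"

definition cyc_module :: "nat \<Rightarrow> ('a::field poly set, 'a poly set \<times> 'a poly set) module"
  where "cyc_module n =
    ring.extend (RDirProd (cyc_ring n) (cyc_ring n))
      (module.fields (\<lambda>r (a, b). (r \<otimes>\<^bsub>cyc_ring n\<^esub> a, r \<otimes>\<^bsub>cyc_ring n\<^esub> b)))"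

text \<open>
  Words are lists over the alphabet. A word \<open>[a\<^sub>0, \<dots>, a\<^sub>n\<^sub>-\<^sub>1]\<close> of length \<open>n\<close> is identified with the
  class of \<open>a\<^sub>0 + a\<^sub>1 x + \<dots> + a\<^sub>n\<^sub>-\<^sub>1 x\<^sup>n\<^sup>-\<^sup>1\<close>, which is \<open>Poly [a\<^sub>0, \<dots>, a\<^sub>n\<^sub>-\<^sub>1]\<close>.
\<close>

definition ideal_words :: "nat \<Rightarrow> 'a::field poly set set \<Rightarrow> 'a list set"
  where "ideal_words n I = {v. length v = n \<and> cyc_class n (Poly v) \<in> I}"

definition module_words ::
    "nat \<Rightarrow> ('a::field poly set \<times> 'a poly set) set \<Rightarrow> 'a list set"
  where "module_words n N =
    {v. length v = 2 * n \<and>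
        (cyc_class n (Poly (take n v)), cyc_class n (Poly (drop n v))) \<in> N}"

definition hamming_dist :: "'a list \<Rightarrow> 'a list \<Rightarrow> nat"
  where "hamming_dist u v = card {i. i < length u \<and> u ! i \<noteq> v ! i}"

text \<open>The infimum over the empty set is \<open>\<infinity>\<close>, so the zero code has minimum distance \<open>\<infinity>\<close>.\<close>

definition min_dist :: "'a list set \<Rightarrow> enat"
  where "min_dist C = Inf {enat (hamming_dist u v) | u v. u \<in> C \<and> v \<in> C \<and> u \<noteq> v}"

definition cyclic_dist :: "nat \<Rightarrow> 'a::field poly set \<Rightarrow> enat"
  where "cyclic_dist n c = min_dist (ideal_words n (PIdl\<^bsub>cyc_ring n\<^esub> c))"

definition qc_submodule ::
    "nat \<Rightarrow> 'a::field poly \<Rightarrow> 'a poly \<Rightarrow> 'a poly \<Rightarrow> ('a poly set \<times> 'a poly set) set"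
  where "qc_submodule n f g h =
    (\<lambda>N. submodule N (cyc_ring n) (cyc_module n)) hull
      {(cyc_class n f, cyc_class n (h * f)), (\<zero>\<^bsub>cyc_ring n\<^esub>, cyc_class n g)}"

definition qc_code :: "nat \<Rightarrow> 'a::field poly \<Rightarrow> 'a poly \<Rightarrow> 'a poly \<Rightarrow> 'a list set"
  where "qc_code n f g h = module_words n (qc_submodule n f g h)"

definition qc_bound ::
    "nat \<Rightarrow> 'a::field_gcd poly \<Rightarrow> 'a poly \<Rightarrow> 'a poly \<Rightarrow> enat"
  where "qc_bound n f g h = Min
    {cyclic_dist n (cyc_class n g),
     cyclic_dist n (cyc_class n (cyc_modulus n div gcd (cyc_modulus n) h)),
     cyclic_dist n (cyc_class n (lcm f (g div gcd g h))),
     cyclic_dist n (cyc_class n f) + cyclic_dist n (cyc_class n (gcd (h * f) g))}"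


lemma cyc_ideal_ideal: "ideal (cyc_ideal n) poly_ring_of_type"
  unfolding cyc_ideal_def
  by (rule cring.cgenideal_ideal[OF cring_from_type_algebra]) (simp add: ring_of_type_algebra_def)

lemma cyc_ring_cring: "cring (cyc_ring n)"
  unfolding cyc_ring_def
  by (rule ideal.quotient_is_cring[OF cyc_ideal_ideal cring_from_type_algebra])

lemma carrier_cyc_module: "carrier (cyc_module n) = carrier (cyc_ring n) \<times> carrier (cyc_ring n)"
  by (simp add: cyc_module_def ring.defs module.defs RDirProd_carrier)

lemma add_cyc_module: "(a, b) \<oplus>\<^bsub>cyc_module n\<^esub> (c, d) = (a \<oplus>\<^bsub>cyc_ring n\<^esub> c, b \<oplus>\<^bsub>cyc_ring n\<^esub> d)"
  by (simp add: cyc_module_def ring.defs module.defs RDirProd_def monoid.defs DirProd_def)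

lemma zero_cyc_module: "\<zero>\<^bsub>cyc_module n\<^esub> = (\<zero>\<^bsub>cyc_ring n\<^esub>, \<zero>\<^bsub>cyc_ring n\<^esub>)"
  by (simp add: cyc_module_def ring.defs module.defs RDirProd_def monoid.defs DirProd_def)

lemma smult_cyc_module:
  "r \<odot>\<^bsub>cyc_module n\<^esub> (a, b) = (r \<otimes>\<^bsub>cyc_ring n\<^esub> a, r \<otimes>\<^bsub>cyc_ring n\<^esub> b)"
  by (simp add: cyc_module_def ring.defs module.defs)

lemma cyc_module_module: "module (cyc_ring n) (cyc_module n)"
proof -
  interpret R: cring "cyc_ring n :: 'a poly set ring" by (rule cyc_ring_cring)
  show ?thesis
  proof (rule moduleI)
    show "abelian_group (cyc_module n :: ('a poly set, _) module)"
    proof (rule abelian_groupI, goal_cases)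
      case (6 x)
      then obtain a b where x: "x = (a, b)" "a \<in> carrier (cyc_ring n)" "b \<in> carrier (cyc_ring n)"
        by (auto simp: carrier_cyc_module)
      show ?case
        by (rule bexI[of _ "(\<ominus>\<^bsub>cyc_ring n\<^esub> a, \<ominus>\<^bsub>cyc_ring n\<^esub> b)"])
           (use x in \<open>auto simp: carrier_cyc_module add_cyc_module zero_cyc_module R.l_neg\<close>)
    qed (auto simp: carrier_cyc_module add_cyc_module zero_cyc_module R.a_ac)
  qed (auto simp: carrier_cyc_module add_cyc_module smult_cyc_module R.l_distr R.r_distr
        R.m_assoc R.is_cring)
qed

lemma cyc_class_eq_iff: "cyc_class n a = cyc_class n b \<longleftrightarrow> cyc_modulus n dvd a - b"
proof -
  interpret ideal "cyc_ideal n" "poly_ring_of_type :: 'a poly ring" by (rule cyc_ideal_ideal)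
  have I: "cyc_ideal n = {x. cyc_modulus n dvd (x :: 'a poly)}"
    by (auto simp: cyc_ideal_def cgenideal_def ring_of_type_algebra_def dvd_def mult.commute)
  have c: "cyc_class n a = {x. cyc_modulus n dvd x - (a :: 'a poly)}" for a
  proof (rule Set.set_eqI, rule iffI)
    fix x assume "x \<in> {x. cyc_modulus n dvd x - a}"
    then show "x \<in> cyc_class n a"
      by (auto simp: cyc_class_def a_r_coset_def r_coset_def I ring_of_type_algebra_def
          intro!: exI[of _ "x - a"])
  qed (auto simp: cyc_class_def a_r_coset_def r_coset_def I ring_of_type_algebra_def)
  show ?thesis
  proof
    assume "cyc_class n a = cyc_class n b"
    moreover have "a \<in> cyc_class n a" by (simp add: c)
    ultimately show "cyc_modulus n dvd a - b" by (simp add: c)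
  next
    assume d: "cyc_modulus n dvd a - b"
    have "cyc_modulus n dvd x - a \<longleftrightarrow> cyc_modulus n dvd x - b" for x
      using dvd_add_left_iff[OF d, of "x - a"] by simp
    then show "cyc_class n a = cyc_class n b" by (simp add: c)
  qed
qed

lemma monic_gcd: "p \<noteq> 0 \<Longrightarrow> Polynomial.lead_coeff (gcd p (r::'a::field_gcd poly)) = 1"
proof -
  assume "p \<noteq> 0"
  then have "unit_factor (gcd p r) = 1" and nz: "gcd p r \<noteq> 0" by (auto simp: unit_factor_gcd)
  then have "unit_factor (Polynomial.lead_coeff (gcd p r)) = 1"
    by (simp add: unit_factor_poly_def one_pCons)
  moreover have "is_unit (Polynomial.lead_coeff (gcd p r))"
    using nz by (simp add: dvd_field_iff)
  ultimately show ?thesis by (metis is_unit_unit_factor)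
qed

end

theory Submission
  imports Defs
begin

text \<open>
  Write \<open>m = x\<^sup>n - 1\<close>. A codeword is \<open>(a f, a h f + b g)\<close> modulo \<open>m\<close>. If its first half vanishes,
  then \<open>m\<close> divides \<open>a f\<close>, hence \<open>a h f\<close>, and the second half lies in the code of \<open>g\<close>. If its
  second half vanishes, then \<open>g\<close> divides \<open>h a f\<close> because \<open>g\<close> divides \<open>m\<close>, so \<open>a f\<close> is a multiple
  of \<open>lcm(f, g / gcd(g, h))\<close>. Otherwise both halves are nonzero and lie in the codes of \<open>f\<close> and
  of \<open>gcd(h f, g)\<close>. The second term of the minimum never enters.
\<close>

text \<open>This is the canonical projection onto the quotient. It moves computations in
  \<open>cyc_ring n\<close> back to polynomial arithmetic.\<close>

lemma cyc_class_ring_hom: "cyc_class n \<in> ring_hom poly_ring_of_type (cyc_ring n)"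
  using ideal.rcos_ring_hom[OF cyc_ideal_ideal, of n]
  by (simp add: cyc_class_def[abs_def] cyc_ring_def)

lemma cyc_class_in_carrier [simp]: "cyc_class n a \<in> carrier (cyc_ring n)"
  using ring_hom_closed[OF cyc_class_ring_hom, of a n] by (simp add: ring_of_type_algebra_def)

lemma cyc_class_mult:
  "cyc_class n a \<otimes>\<^bsub>cyc_ring n\<^esub> cyc_class n b = cyc_class n (a * b)"
  using ring_hom_mult[OF cyc_class_ring_hom, of a b n] by (simp add: ring_of_type_algebra_def)

lemma cyc_class_add:
  "cyc_class n a \<oplus>\<^bsub>cyc_ring n\<^esub> cyc_class n b = cyc_class n (a + b)"
  using ring_hom_add[OF cyc_class_ring_hom, of a b n] by (simp add: ring_of_type_algebra_def)

lemma cyc_class_zero: "\<zero>\<^bsub>cyc_ring n\<^esub> = cyc_class n (0 :: 'a::field poly)"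
  using ring_hom_zero[OF cyc_class_ring_hom[where ?'a = 'a, of n] cring.axioms(1)[OF cring_from_type_algebra]
      cring.axioms(1)[OF cyc_ring_cring]]
  by (simp add: ring_of_type_algebra_def)

lemma cyc_class_surj:
  assumes "r \<in> carrier (cyc_ring n)"
  obtains a where "r = cyc_class n a"
  using assms
  by (auto simp: cyc_ring_def FactRing_def A_RCOSETS_def' cyc_class_def)

text \<open>Every multiplier in the quotient is the class of some polynomial \<open>r\<close>, so
  ideal membership becomes a divisibility between polynomials.\<close>

lemma cyc_class_in_cgenideal_iff:
  "cyc_class n p \<in> PIdl\<^bsub>cyc_ring n\<^esub> (cyc_class n c) \<longleftrightarrow> (\<exists>r. cyc_modulus n dvd p - r * c)"
  unfolding cgenideal_def
  by (auto simp: cyc_class_mult cyc_class_eq_iff elim!: cyc_class_surj)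
    (metis cyc_class_in_carrier cyc_class_mult cyc_class_eq_iff)

lemma Poly_map2_minus:
  "length u = length v \<Longrightarrow> Poly (map2 (-) u v) = Poly u - Poly v"
  by (induction rule: list_induct2) auto

lemma min_dist_le:
  "u \<in> C \<Longrightarrow> v \<in> C \<Longrightarrow> u \<noteq> v \<Longrightarrow> min_dist C \<le> enat (hamming_dist u v)"
  unfolding min_dist_def by (rule Inf_lower) blast

lemma le_min_dist:
  "(\<And>u v. u \<in> C \<Longrightarrow> v \<in> C \<Longrightarrow> u \<noteq> v \<Longrightarrow> b \<le> enat (hamming_dist u v)) \<Longrightarrow> b \<le> min_dist C"
  unfolding min_dist_def by (rule Inf_greatest) blast

text \<open>Equal lengths of the first blocks align the second ones. The mismatches of the second
  blocks are then shifted by \<open>length u\<close>, and the shift is injective.\<close>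

lemma hamming_dist_append:
  assumes "length u = length u'"
  shows "hamming_dist (u @ v) (u' @ v') = hamming_dist u u' + hamming_dist v v'"
proof -
  have "{i. i < length (u @ v) \<and> (u @ v) ! i \<noteq> (u' @ v') ! i}
      = {i. i < length u \<and> u ! i \<noteq> u' ! i}
        \<union> (+) (length u) ` {i. i < length v \<and> v ! i \<noteq> v' ! i}" (is "?L = ?A \<union> ?B")
  proof (intro Set.set_eqI iffI)
    fix i assume i: "i \<in> ?L"
    show "i \<in> ?A \<union> ?B"
    proof (cases "i < length u")
      case False
      then have "i = length u + (i - length u)" by simp
      with i False assms show ?thesis
        by (intro UnI2 image_eqI[of _ _ "i - length u"]) (auto simp: nth_append)
    qed (use i assms in \<open>auto simp: nth_append\<close>)
  qed (use assms in \<open>auto simp: nth_append\<close>)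
  moreover have "card (?A \<union> ?B) = card ?A + card ?B"
    by (rule card_Un_disjoint) auto
  ultimately show ?thesis
    by (simp add: hamming_dist_def card_image)
qed

text \<open>By linearity only the difference of the words has to lie in the cyclic code. The words
  \<open>u\<close> and \<open>v\<close> themselves may lie outside it: the pair compared inside the
  code is their difference and the zero word.\<close>

lemma cyclic_dist_le:
  assumes "length u = n" "length v = n" "u \<noteq> v"
    and "cyc_modulus n dvd Poly u - Poly v - r * c"
  shows "cyclic_dist n (cyc_class n c) \<le> enat (hamming_dist u v)"
proof -
  let ?w = "map2 (-) u v" and ?z = "replicate n 0"
  let ?C = "ideal_words n (PIdl\<^bsub>cyc_ring n\<^esub> (cyc_class n c))"
  have "?w \<in> ?C"
    using assms
    by (auto simp: ideal_words_def cyc_class_in_cgenideal_iff Poly_map2_minus)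
  moreover have "?z \<in> ?C"
    by (auto simp: ideal_words_def cyc_class_in_cgenideal_iff intro!: exI[of _ 0])
  moreover have "?w \<noteq> ?z"
    using assms(1-3) by (auto simp: list_eq_iff_nth_eq)
  \<comment> \<open>The difference vanishes exactly at the positions where \<open>u\<close> and
    \<open>v\<close> agree.\<close>
  moreover have "{i. i < length ?w \<and> ?w ! i \<noteq> ?z ! i} = {i. i < length u \<and> u ! i \<noteq> v ! i}"
    using assms(1,2) by auto
  then have "hamming_dist ?w ?z = hamming_dist u v"
    by (simp only: hamming_dist_def)
  ultimately show ?thesis
    unfolding cyclic_dist_def by (metis min_dist_le)
qed

text \<open>The hull is the least submodule containing the two generators, so it is enough that the
  explicit set contains them and is itself a submodule. For a lower bound on distances this
  inclusion suffices.\<close>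

lemma qc_submodule_subset:
  "qc_submodule n f g h \<subseteq> {(cyc_class n (a * f), cyc_class n (a * (h * f) + b * g)) | a b. True}"
  (is "_ \<subseteq> ?N")
  unfolding qc_submodule_def
proof (rule hull_minimal)
  have "(cyc_class n f, cyc_class n (h * f)) \<in> ?N"
    by (simp, rule exI[of _ 1], simp, rule exI[of _ 0], simp)
  moreover have "(\<zero>\<^bsub>cyc_ring n\<^esub>, cyc_class n g) \<in> ?N"
    by (simp add: cyc_class_zero, rule exI[of _ 0], simp, rule exI[of _ 1], simp)
  ultimately show "{(cyc_class n f, cyc_class n (h * f)), (\<zero>\<^bsub>cyc_ring n\<^esub>, cyc_class n g)} \<subseteq> ?N"
    by simp
  interpret M: module "cyc_ring n" "cyc_module n :: (_, 'a poly set \<times> 'a poly set) module"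
    by (rule cyc_module_module)
  have smult: "r \<odot>\<^bsub>cyc_module n\<^esub> x \<in> ?N" if r: "r \<in> carrier (cyc_ring n)" and x: "x \<in> ?N" for r x
  proof -
    from r obtain s where s: "r = cyc_class n s" by (rule cyc_class_surj)
    from x obtain a b
      where "x = (cyc_class n (a * f), cyc_class n (a * (h * f) + b * g))" by blast
    then have "r \<odot>\<^bsub>cyc_module n\<^esub> x =
      (cyc_class n ((s * a) * f), cyc_class n ((s * a) * (h * f) + (s * b) * g))"
      by (simp add: s smult_cyc_module cyc_class_mult algebra_simps)
    then show ?thesis by blast
  qed
  have carrier: "?N \<subseteq> carrier (cyc_module n)"
    by (auto simp: carrier_cyc_module)
  show "submodule ?N (cyc_ring n) (cyc_module n)"
  proof (rule M.submoduleI)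
    show "?N \<subseteq> carrier (cyc_module n)" by (rule carrier)
    show "\<zero>\<^bsub>cyc_module n\<^esub> \<in> ?N"
      by (simp add: zero_cyc_module cyc_class_zero, rule exI[of _ 0], simp, rule exI[of _ 0], simp)
    show "\<ominus>\<^bsub>cyc_module n\<^esub> x \<in> ?N" if "x \<in> ?N" for x
    proof -
      \<comment> \<open>Negation is scaling by minus one, which reduces this closure to
        \<open>smult\<close>.\<close>
      have "\<ominus>\<^bsub>cyc_module n\<^esub> x = (\<ominus>\<^bsub>cyc_ring n\<^esub> \<one>\<^bsub>cyc_ring n\<^esub>) \<odot>\<^bsub>cyc_module n\<^esub> x"
        using M.smult_l_minus[OF M.R.one_closed subsetD[OF carrier that]]
          M.smult_one[OF subsetD[OF carrier that]] by simp
      with smult[OF _ that] show ?thesis by simp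
    qed
    show "x \<oplus>\<^bsub>cyc_module n\<^esub> y \<in> ?N" if "x \<in> ?N" "y \<in> ?N" for x y
    proof -
      from that obtain a b c d
        where "x = (cyc_class n (a * f), cyc_class n (a * (h * f) + b * g))"
          and "y = (cyc_class n (c * f), cyc_class n (c * (h * f) + d * g))" by blast
      then have "x \<oplus>\<^bsub>cyc_module n\<^esub> y =
        (cyc_class n ((a + c) * f), cyc_class n ((a + c) * (h * f) + (b + d) * g))"
        by (simp add: add_cyc_module cyc_class_add algebra_simps)
      then show ?thesis by blast
    qed
    show "r \<odot>\<^bsub>cyc_module n\<^esub> x \<in> ?N" if "r \<in> carrier (cyc_ring n)" "x \<in> ?N" for r x
      using that by (rule smult)
  qed
qed

text \<open>Subtracting the representations of \<open>u\<close> and \<open>v\<close> gives one of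
  their difference. The point is that the same multiplier \<open>a\<close> governs both
  halves.\<close>

lemma qc_code_diff:
  assumes "u \<in> qc_code n f g h" "v \<in> qc_code n f g h"
  obtains a b where
    "cyc_modulus n dvd Poly (take n u) - Poly (take n v) - a * f"
    "cyc_modulus n dvd Poly (drop n u) - Poly (drop n v) - (a * (h * f) + b * g)"
proof -
  let ?m = "cyc_modulus n :: 'a poly"
  have rep: "\<exists>a b. ?m dvd Poly (take n w) - a * f
      \<and> ?m dvd Poly (drop n w) - (a * (h * f) + b * g)" if "w \<in> qc_code n f g h" for w
  proof -
    have "(cyc_class n (Poly (take n w)), cyc_class n (Poly (drop n w)))
        \<in> {(cyc_class n (a * f), cyc_class n (a * (h * f) + b * g)) | a b. True}"
      using that qc_submodule_subset[of n f g h]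
      unfolding qc_code_def module_words_def by blast
    then show ?thesis by (simp add: cyc_class_eq_iff)
  qed
  obtain a b where ab: "?m dvd Poly (take n u) - a * f"
      "?m dvd Poly (drop n u) - (a * (h * f) + b * g)"
    using rep[OF assms(1)] by blast
  obtain c d where cd: "?m dvd Poly (take n v) - c * f"
      "?m dvd Poly (drop n v) - (c * (h * f) + d * g)"
    using rep[OF assms(2)] by blast
  show ?thesis
  proof (rule that)
    show "?m dvd Poly (take n u) - Poly (take n v) - (a - c) * f"
      using dvd_diff[OF ab(1) cd(1)] by (simp add: algebra_simps)
    show "?m dvd Poly (drop n u) - Poly (drop n v) - ((a - c) * (h * f) + (b - d) * g)"
      using dvd_diff[OF ab(2) cd(2)] by (simp add: algebra_simps)
  qed
qed

text \<open>Cancel \<open>gcd g h\<close> on both sides; what remains of \<open>g\<close> is coprime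
  to what remains of \<open>h\<close>, hence divides \<open>p\<close>.\<close>

lemma div_gcd_dvd:
  fixes g h p :: "'a::semiring_gcd"
  assumes "g \<noteq> 0" "g dvd h * p"
  shows "g div gcd g h dvd p"
proof -
  have nz: "gcd g h \<noteq> 0" using assms(1) by simp
  have "g = gcd g h * (g div gcd g h)" "h * p = gcd g h * (h div gcd g h * p)"
    by (simp_all flip: mult.assoc)
  with assms(2) nz have "g div gcd g h dvd h div gcd g h * p"
    by (metis dvd_times_left_cancel_iff)
  moreover have "coprime (g div gcd g h) (h div gcd g h)"
    using assms(1) by (intro div_gcd_coprime) auto
  ultimately show ?thesis by (simp add: coprime_dvd_mult_right_iff)
qed

theorem proposition11:
  fixes q n :: nat
    and f g h :: "'a::{field_gcd, finite} poly"
  assumes "primepow q" and "card (UNIV :: 'a set) = q"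
    and "n \<ge> 1"
    and "Polynomial.lead_coeff f = 1"
    and "Polynomial.lead_coeff g = 1"
    and "Polynomial.lead_coeff h = 1"
    and "Polynomial.degree f < n"
    and "Polynomial.degree g < n"
    and "Polynomial.degree h < n"
    and "f dvd Polynomial.monom 1 n - 1"
    and "g dvd Polynomial.monom 1 n - 1"
  shows "qc_bound n f g h \<le> min_dist (qc_code n f g h)"
proof (rule le_min_dist)
  let ?m = "cyc_modulus n :: 'a poly"
  fix u v assume u: "u \<in> qc_code n f g h" and v: "v \<in> qc_code n f g h" and "u \<noteq> v"
  have len: "length u = 2 * n" "length v = 2 * n"
    using u v by (auto simp: qc_code_def module_words_def)
  obtain a b where
    ab1: "?m dvd Poly (take n u) - Poly (take n v) - a * f" and
    ab2: "?m dvd Poly (drop n u) - Poly (drop n v) - (a * (h * f) + b * g)"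
    using u v by (rule qc_code_diff)
  have gm: "g dvd ?m" and g0: "g \<noteq> 0"
    using assms by (auto simp: cyc_modulus_def)
  have dist: "hamming_dist u v =
      hamming_dist (take n u) (take n v) + hamming_dist (drop n u) (drop n v)"
    using hamming_dist_append[of "take n u" "take n v" "drop n u" "drop n v"] len by simp
  have "take n u \<noteq> take n v \<or> drop n u \<noteq> drop n v"
    using \<open>u \<noteq> v\<close> by (metis append_take_drop_id)
  \<comment> \<open>In each case it is enough to bound one entry of the minimum
    \<open>qc_bound\<close>.\<close>
  then consider
      (first) "take n u = take n v" "drop n u \<noteq> drop n v"
    | (second) "take n u \<noteq> take n v" "drop n u = drop n v"
    | (both) "take n u \<noteq> take n v" "drop n u \<noteq> drop n v"
    by blast
  then show "qc_bound n f g h \<le> enat (hamming_dist u v)"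
  proof cases
    case first
    \<comment> \<open>With equal first halves, \<open>ab1\<close> says up to sign that
      \<open>?m\<close> divides \<open>a * f\<close>. Multiplying by \<open>h\<close> removes the
      mixed term from \<open>ab2\<close>.\<close>
    have "?m dvd h * (a * f)"
      using ab1 first by (intro dvd_mult[of _ "a * f"]) simp
    from dvd_add[OF ab2 this] have "?m dvd Poly (drop n u) - Poly (drop n v) - b * g"
      by (simp add: algebra_simps)
    then have "cyclic_dist n (cyc_class n g) \<le> enat (hamming_dist (drop n u) (drop n v))"
      using first len by (intro cyclic_dist_le) auto
    also have "\<dots> \<le> enat (hamming_dist u v)" by (simp add: dist)
    finally show ?thesis
      by (simp add: qc_bound_def min.coboundedI1)
  next
    case second
    let ?l = "lcm f (g div gcd g h)"
    \<comment> \<open>The difference of the second halves is zero, so \<open>ab2\<close> leaves only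
      this sum. Reducing modulo \<open>g\<close> then discards \<open>b * g\<close>.\<close>
    have "?m dvd h * (a * f) + b * g"
      using ab2 second by (simp add: dvd_diff_commute algebra_simps flip: dvd_minus_iff[of _ "_ + _"])
    with gm have "g dvd h * (a * f) + b * g" by (rule dvd_trans)
    then have "g dvd h * (a * f)" by (simp add: dvd_add_left_iff)
    with g0 have "g div gcd g h dvd a * f" by (rule div_gcd_dvd)
    then have "?l dvd a * f" by (intro lcm_least) auto
    then obtain r where r: "a * f = r * ?l" by (metis dvdE mult.commute)
    \<comment> \<open>Replacing \<open>a * f\<close> by \<open>r * ?l\<close> in \<open>ab1\<close>
      places the difference of the first halves in the smaller code generated by
      \<open>?l\<close>.\<close>
    have "cyclic_dist n (cyc_class n ?l) \<le> enat (hamming_dist (take n u) (take n v))"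
      using second len ab1 unfolding r by (intro cyclic_dist_le) auto
    also have "\<dots> \<le> enat (hamming_dist u v)" by (simp add: dist)
    finally show ?thesis
      by (simp add: qc_bound_def min.coboundedI1 min.coboundedI2)
  next
    case both
    let ?d = "gcd (h * f) g"
    \<comment> \<open>Here the halves are estimated separately, the second as a multiple of
      \<open>?d\<close>; since they occupy disjoint coordinates, the two bounds add up.\<close>
    have "?d dvd a * (h * f) + b * g" by (rule dvd_add) (rule dvd_mult, simp)+
    then obtain r where r: "a * (h * f) + b * g = r * ?d" by (metis dvdE mult.commute)
    have "cyclic_dist n (cyc_class n f) \<le> enat (hamming_dist (take n u) (take n v))"
      using both len ab1 by (intro cyclic_dist_le) auto
    moreover have "cyclic_dist n (cyc_class n ?d) \<le> enat (hamming_dist (drop n u) (drop n v))"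
      using both len ab2 unfolding r by (intro cyclic_dist_le) auto
    ultimately have "cyclic_dist n (cyc_class n f) + cyclic_dist n (cyc_class n ?d)
        \<le> enat (hamming_dist u v)"
      unfolding dist plus_enat_simps(1)[symmetric] by (rule add_mono)
    then show ?thesis
      by (simp add: qc_bound_def min.coboundedI2)
  qed
qed

end
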